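(* Let $f$ be a Kneser function of order $d\ge1$. If $$0<\liminf_{r\to 0} \frac{f(r)}{r^s}\le\limsup_{r\to 0} \frac{f(r)}{r^s}<\infty$$ for some $s\in(0,\infty)$, then $$0<\liminf_{r\to 0} \frac{f'_+(r)}{r^{s-1}}\le \limsup_{r\to 0} \frac{f'_-(r)}{r^{s-1}}<\infty .$$
   Context: A function $f:(0,\infty)\to(0,\infty)$ is called a Kneser function of order $d\ge1$ if for all $0<a\le b<\infty$ and all $\lambda\ge1$, $$f(\lambda b)-f(\lambda a)\le\lambda^d\,(f(b)-f(a)).$$ $f'_+$ and $f'_-$ denote the right and left derivatives of $f$; it is known (Stach\'o) that for a Kneser function both exist at every $r>0$, with $f'_+(r)\le f'_-(r)$. Limits are taken as $r\searrow0$. *)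

theory Defs
  imports "HOL-Analysis.Analysis"
begin

text \<open>
  Functions on the open half-line are total functions on the reals of which only the values at
  positive arguments matter. The order may be any real number; for a natural number \<open>d\<close> and
  \<open>\<lambda> \<ge> 1\<close>, \<open>\<lambda> powr d\<close> is the ordinary power.
\<close>

definition Kneser_function :: "real \<Rightarrow> (real \<Rightarrow> real) \<Rightarrow> bool" where
  "Kneser_function d f \<longleftrightarrow>
     (\<forall>r>0. f r > 0) \<and>
     (\<forall>a b l. 0 < a \<and> a \<le> b \<and> 1 \<le> l \<longrightarrow>
        f (l * b) - f (l * a) \<le> l powr d * (f b - f a))"

text \<open>
  The one-sided derivatives are unspecified where they do not exist. For a Kneser function they
  exist, with a finite value, at every positive argument.
\<close>

definition right_deriv :: "(real \<Rightarrow> real) \<Rightarrow> real \<Rightarrow> real" where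
  "right_deriv f r = vector_derivative f (at_right r)"

definition left_deriv :: "(real \<Rightarrow> real) \<Rightarrow> real \<Rightarrow> real" where
  "left_deriv f r = vector_derivative f (at_left r)"

lemma right_deriv_eqI:
  assumes "(f has_real_derivative D) (at_right r)"
  shows "right_deriv f r = D"
  unfolding right_deriv_def
  using assms by (intro vector_derivative_within)
    (auto simp: has_real_derivative_iff_has_vector_derivative)

lemma left_deriv_eqI:
  assumes "(f has_real_derivative D) (at_left r)"
  shows "left_deriv f r = D"
  unfolding left_deriv_def
  using assms by (intro vector_derivative_within)
    (auto simp: has_real_derivative_iff_has_vector_derivative)

end

theory Submission
  imports Defs
begin

text \<open>
  In the variable \<open>u = r powr d\<close> a Kneser function becomes a concave function, because the
  defining inequality says that an increment over an interval grows at most by the factor by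
  which the interval is stretched (lemmas \<open>Kneser_function_order_one\<close> and
  \<open>Kneser_order_one_concave\<close>). A concave function has one-sided derivatives, the right one
  not exceeding the left one, and its slope over any interval to the right of a point is at most
  the right derivative there, while its slope over any interval to the left is at least the left
  derivative. Back in the variable \<open>r\<close> this compares the derivatives at \<open>r\<close> with difference
  quotients between \<open>r\<close> and \<open>k * r\<close> for a fixed factor \<open>k\<close>
  (lemma \<open>Kneser_function_one_sided_derivs\<close>).

  Suppose now that \<open>c * r powr s < f r < C * r powr s\<close> for small \<open>r\<close>. For the upper bound take
  \<open>k = 1 / 2\<close>: as \<open>f\<close> is positive, the increment over \<open>[r / 2, r]\<close> is below \<open>C * r powr s\<close>,
  which gives a left derivative of order at most \<open>r powr (s - 1)\<close>. For the lower bound choose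
  \<open>k\<close> so large that \<open>c * k powr s\<close> is at least \<open>2 * C\<close>: then \<open>f (k * r) - f r\<close> is at least
  \<open>C * r powr s\<close>, and the right derivative is at least of order \<open>r powr (s - 1)\<close>.
\<close>

section \<open>Monotonicity and reduction to order 1\<close>

lemma Kneser_functionD:
  assumes "Kneser_function d f" "0 < a" "a \<le> b" "1 \<le> l"
  shows "f (l * b) - f (l * a) \<le> l powr d * (f b - f a)"
  using assms unfolding Kneser_function_def by blast

lemma Kneser_function_pos: "Kneser_function d f \<Longrightarrow> 0 < r \<Longrightarrow> 0 < f r"
  unfolding Kneser_function_def by blast

text \<open>
  A decrease from \<open>a\<close> to \<open>b\<close> would recur, with at least the same size, between consecutive
  terms of the geometric progression with ratio \<open>b / a\<close>, and so contradict positivity.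
\<close>

lemma Kneser_function_mono:
  assumes K: "Kneser_function d f" and d: "0 \<le> d" and a: "0 < a" and ab: "a \<le> b"
  shows "f a \<le> f b"
proof (rule ccontr)
  assume "\<not> f a \<le> f b"
  define e where "e = f a - f b"
  define l where "l = b / a"
  have e: "0 < e" using \<open>\<not> f a \<le> f b\<close> by (simp add: e_def)
  have l: "1 \<le> l" and b: "b = l * a" using a ab by (auto simp: l_def)
  have drop: "f (l ^ Suc n * a) \<le> f (l ^ n * a) - e" for n
  proof -
    have ln: "1 \<le> l ^ n" using l by (rule one_le_power)
    have "f (l ^ n * b) - f (l ^ n * a) \<le> (l ^ n) powr d * (- e)"
      using Kneser_functionD[OF K a ab ln] by (simp add: e_def)
    also have "\<dots> \<le> 1 * (- e)"
      using e ge_one_powr_ge_zero[OF ln d] by (intro mult_right_mono_neg) auto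
    finally show ?thesis by (simp add: b mult_ac)
  qed
  have le: "f (l ^ n * a) \<le> f a - real n * e" for n
  proof (induction n)
    case (Suc n)
    then show ?case using drop[of n] by (simp add: algebra_simps)
  qed simp
  obtain n where "f a < real n * e"
    using reals_Archimedean3[OF e] by blast
  moreover have "0 < f (l ^ n * a)"
    using a l by (intro Kneser_function_pos[OF K]) auto
  ultimately show False using le[of n] by simp
qed

text \<open>
  Measuring radii by their \<open>d\<close>-th power turns the factor \<open>\<lambda> powr d\<close> into \<open>\<lambda>\<close>, so that only
  order 1 has to be studied.
\<close>

lemma Kneser_function_order_one:
  assumes K: "Kneser_function d f" and d: "0 < d"
  shows "Kneser_function 1 (\<lambda>u. f (u powr (1 / d)))"
  unfolding Kneser_function_def
proof (intro conjI allI impI)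
  fix r :: real assume "0 < r"
  then show "0 < f (r powr (1 / d))" by (intro Kneser_function_pos[OF K]) auto
next
  fix a b l :: real
  assume "0 < a \<and> a \<le> b \<and> 1 \<le> l"
  then have *: "0 < a" "a \<le> b" "1 \<le> l" by auto
  have "f (l powr (1 / d) * b powr (1 / d)) - f (l powr (1 / d) * a powr (1 / d))
      \<le> (l powr (1 / d)) powr d * (f (b powr (1 / d)) - f (a powr (1 / d)))"
    using * d by (intro Kneser_functionD[OF K]) (auto intro: powr_mono2 ge_one_powr_ge_zero)
  moreover have "(l powr (1 / d)) powr d = l powr 1"
    using d by (simp add: powr_powr)
  ultimately show "f ((l * b) powr (1 / d)) - f ((l * a) powr (1 / d))
      \<le> l powr 1 * (f (b powr (1 / d)) - f (a powr (1 / d)))"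
    using * by (simp add: powr_mult)
qed

section \<open>Concavity of Kneser functions of order 1\<close>

text \<open>
  For order 1 the Kneser inequality with \<open>\<lambda> = q\<close> says that the slopes between consecutive terms
  of a geometric progression decrease. Hence the line through the \<open>k\<close>-th term with the
  slope \<open>c\<close> of the next segment lies above the function at all terms.
\<close>

lemma Kneser_order_one_support_on_progression:
  assumes K: "Kneser_function 1 F" and x: "0 < x" and q: "1 < q"
  obtains c where "0 \<le> c"
    and "\<And>j. F (x * q ^ j) \<le> F (x * q ^ k) + c * (x * q ^ j - x * q ^ k)"
proof -
  define m where "m i = (F (x * q ^ Suc i) - F (x * q ^ i)) / (x * q ^ Suc i - x * q ^ i)" for i
  have pos: "0 < x * q ^ Suc i - x * q ^ i" for i
    using x q by simp
  have m: "F (x * q ^ Suc i) - F (x * q ^ i) = m i * (x * q ^ Suc i - x * q ^ i)" for i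
    unfolding m_def using pos[of i] by (metis less_irrefl nonzero_eq_divide_eq)
  have m_Suc: "m (Suc i) \<le> m i" for i
  proof -
    have "F (q * (x * q ^ Suc i)) - F (q * (x * q ^ i))
        \<le> q powr 1 * (F (x * q ^ Suc i) - F (x * q ^ i))"
      using x q by (intro Kneser_functionD[OF K]) auto
    then have "F (x * q ^ Suc (Suc i)) - F (x * q ^ Suc i)
        \<le> q * (F (x * q ^ Suc i) - F (x * q ^ i))"
      using q by (simp add: mult_ac)
    also have "\<dots> = m i * (x * q ^ Suc (Suc i) - x * q ^ Suc i)"
      by (simp only: m) (simp add: algebra_simps)
    finally show ?thesis using pos[of "Suc i"] unfolding m_def[of "Suc i"]
      by (simp only: pos_divide_le_eq)
  qed
  have anti: "m i \<le> m j" if "j \<le> i" for i j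
    using lift_Suc_antimono_le[of m, OF m_Suc that] .
  have "0 \<le> m k"
    using Kneser_function_mono[OF K, of "x * q ^ k" "x * q ^ Suc k"] pos[of k] x q
    by (simp add: m_def)
  moreover have "F (x * q ^ j) \<le> F (x * q ^ k) + m k * (x * q ^ j - x * q ^ k)" for j
  proof (cases "k \<le> j")
    case True
    then show ?thesis
    proof (induction rule: dec_induct)
      case (step i)
      have "m i * (x * q ^ Suc i - x * q ^ i) \<le> m k * (x * q ^ Suc i - x * q ^ i)"
        using anti[OF step(1)] pos[of i] by (intro mult_right_mono) auto
      then show ?case using step.IH m[of i] by (simp only: algebra_simps)
    qed simp
  next
    case False
    then have "j \<le> k" by simp
    then show ?thesis
    proof (induction rule: inc_induct)
      case (step i)
      have "m k * (x * q ^ Suc i - x * q ^ i) \<le> m i * (x * q ^ Suc i - x * q ^ i)"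
        using anti[of i k] step(2) pos[of i] by (intro mult_right_mono) auto
      then show ?case using step.IH m[of i] by (simp only: algebra_simps)
    qed simp
  qed
  ultimately show ?thesis using that by blast
qed

lemma between_consecutive_powers:
  fixes q w :: real
  assumes "1 < q" "1 \<le> w"
  obtains k where "q ^ k \<le> w" "w < q ^ Suc k"
proof -
  define n where "n = (LEAST n. w < q ^ n)"
  have n: "w < q ^ n" unfolding n_def
    using real_arch_pow[OF assms(1), of w] by (rule LeastI_ex)
  then have "n \<noteq> 0" using assms(2) by (intro notI) simp
  then obtain k where k: "n = Suc k" using not0_implies_Suc by blast
  have "\<not> w < q ^ k"
    using not_less_Least[of k "\<lambda>n. w < q ^ n"] k unfolding n_def by simp
  then show ?thesis using that[of k] n k by simp
qed

text \<open>
  A progression starting at \<open>x\<close> need not meet \<open>y\<close> and \<open>z\<close>, but it has a term in \<open>[y / q, y]\<close>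
  and a term in \<open>[z, z * q]\<close>. As the function is monotone, rounding \<open>y\<close> down and \<open>z\<close> up
  weakens the concavity inequality in the right direction, and the error vanishes as
  \<open>q\<close> tends to 1. In this way monotonicity replaces continuity.
\<close>

lemma Kneser_order_one_concave:
  assumes K: "Kneser_function 1 F"
  shows "concave_on {0<..} F"
proof -
  have three_points: "(z - y) * F x + (y - x) * F z \<le> (z - x) * F y"
    if x: "0 < x" and xy: "x < y" and yz: "y < z" for x y z
  proof -
    have approx: "(z * q - y / q) * F x + (y / q - x) * F z \<le> (z * q - x) * F y"
      if q: "1 < q" "q < y / x" for q
    proof -
      have w: "1 \<le> y / x" "1 \<le> z / x" using x xy yz by auto
      obtain k where k: "q ^ k \<le> y / x" "y / x < q ^ Suc k"
        using between_consecutive_powers[OF q(1) w(1)] .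
      obtain n where n: "q ^ n \<le> z / x" "z / x < q ^ Suc n"
        using between_consecutive_powers[OF q(1) w(2)] .
      have y': "x * q ^ k \<le> y" "y / q \<le> x * q ^ k"
        using k x q by (auto simp: field_simps)
      have z': "z \<le> x * q ^ Suc n" "x * q ^ Suc n \<le> z * q"
        using n x q by (auto simp: field_simps)
      obtain c where c: "0 \<le> c"
        and le: "\<And>j. F (x * q ^ j) \<le> F (x * q ^ k) + c * (x * q ^ j - x * q ^ k)"
        using Kneser_order_one_support_on_progression[OF K x q(1)] by metis
      have Fy: "F (x * q ^ k) \<le> F y"
        using y' x q by (intro Kneser_function_mono[OF K]) auto
      have Fz: "F z \<le> F (x * q ^ Suc n)"
        using z' x xy yz by (intro Kneser_function_mono[OF K]) auto
      have "c * (x - x * q ^ k) \<le> c * (x - y / q)"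
        using c y' by (intro mult_left_mono) auto
      then have 1: "F x \<le> F y + c * (x - y / q)"
        using le[of 0] Fy by simp
      have "c * (x * q ^ Suc n - x * q ^ k) \<le> c * (z * q - y / q)"
        using c y' z' by (intro mult_left_mono) linarith+
      then have 2: "F z \<le> F y + c * (z * q - y / q)"
        using le[of "Suc n"] Fy Fz by linarith
      \<comment> \<open>With these two weights the terms containing \<open>c\<close> cancel.\<close>
      have "0 \<le> y / q - x" using q x by (simp add: field_simps)
      moreover have "0 \<le> z * q - y / q"
        using y'(1,2) z' yz by linarith
      ultimately have "(z * q - y / q) * F x + (y / q - x) * F z
          \<le> (z * q - y / q) * (F y + c * (x - y / q)) + (y / q - x) * (F y + c * (z * q - y / q))"
        using 1 2 by (intro add_mono mult_left_mono) auto
      also have "\<dots> = (z * q - x) * F y" by algebra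
      finally show ?thesis .
    qed
    have "((\<lambda>q. (z * q - y / q) * F x + (y / q - x) * F z)
        \<longlongrightarrow> (z * 1 - y / 1) * F x + (y / 1 - x) * F z) (at_right 1)"
      by (intro tendsto_intros) auto
    moreover have "((\<lambda>q. (z * q - x) * F y) \<longlongrightarrow> (z * 1 - x) * F y) (at_right 1)"
      by (intro tendsto_intros)
    moreover have "\<forall>\<^sub>F q in at_right 1.
        (z * q - y / q) * F x + (y / q - x) * F z \<le> (z * q - x) * F y"
      unfolding eventually_at_right_field using approx x xy
      by (intro exI[of _ "y / x"]) auto
    ultimately show ?thesis
      using tendsto_le[of "at_right (1::real)"] by fastforce
  qed
  show ?thesis unfolding concave_on_def
  proof (rule convex_on_linorderI)
    fix t x y :: real
    assume t: "0 < t" "t < 1" and xy: "x \<in> {0<..}" "y \<in> {0<..}" "x < y"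
    let ?u = "(1 - t) * x + t * y"
    have u: "?u = x + t * (y - x)" "?u = y - (1 - t) * (y - x)" by algebra+
    have "(y - ?u) * F x + (?u - x) * F y \<le> (y - x) * F ?u"
    proof (rule three_points)
      show "x < ?u" unfolding u(1) using t xy by simp
      show "?u < y" unfolding u(2) using t xy by simp
    qed (use xy in auto)
    moreover have "(y - ?u) * F x + (?u - x) * F y = (y - x) * ((1 - t) * F x + t * F y)"
      by algebra
    ultimately have "(1 - t) * F x + t * F y \<le> F ?u"
      using xy by simp
    then show "- F ((1 - t) *\<^sub>R x + t *\<^sub>R y) \<le> (1 - t) * - F x + t * - F y"
      by simp
  qed (auto intro: convex_real_interval)
qed

section \<open>One-sided derivatives\<close>

lemma concave_on_slope_antimono:
  fixes F :: "real \<Rightarrow> real"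
  assumes F: "concave_on S F" and S: "u \<in> S" "v \<in> S" "w \<in> S"
    and "v \<noteq> u" "w \<noteq> u" "v \<le> w"
  shows "(F w - F u) / (w - u) \<le> (F v - F u) / (v - u)"
proof -
  have cvx: "convex_on S (\<lambda>x. - F x)" using F by (simp add: concave_on_def)
  consider "v = w" | "u < v" "v < w" | "v < u" "u < w" | "v < w" "w < u"
    using assms by linarith
  then show ?thesis
  proof cases
    case 2
    then show ?thesis using convex_on_slope_le(1)[OF cvx S(1) S(3) 2]
      by (simp add: divide_simps) argo
  next
    case 3
    have "(- F v - - F u) / (v - u) \<le> (- F u - - F w) / (u - w)"
      using convex_on_slope_le[OF cvx S(2) S(3) 3] by linarith
    then show ?thesis using 3 by (simp add: divide_simps) argo
  next
    case 4
    then show ?thesis using convex_on_slope_le(2)[OF cvx S(2) S(1) 4]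
      by (simp add: divide_simps) argo
  qed simp
qed

text \<open>
  Both derivatives are limits of the slope from \<open>u\<close> to \<open>v\<close>, which is monotone in \<open>v\<close>; any slope
  taken on the other side of \<open>u\<close> bounds it, which is where the openness of \<open>S\<close> enters.
\<close>

lemma concave_on_one_sided_derivatives:
  fixes F :: "real \<Rightarrow> real"
  assumes F: "concave_on S F" and S: "open S" "u \<in> S"
  obtains R L where "(F has_real_derivative R) (at_right u)"
    and "(F has_real_derivative L) (at_left u)" and "R \<le> L"
    and "\<And>v. v \<in> S \<Longrightarrow> u < v \<Longrightarrow> (F v - F u) / (v - u) \<le> R"
    and "\<And>v. v \<in> S \<Longrightarrow> v < u \<Longrightarrow> L \<le> (F v - F u) / (v - u)"
proof -
  define p where "p v = (F v - F u) / (v - u)" for v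
  have anti: "p w \<le> p v" if "v \<in> S" "w \<in> S" "v \<noteq> u" "w \<noteq> u" "v \<le> w" for v w
    unfolding p_def using concave_on_slope_antimono[OF F S(2)] that by blast
  obtain \<epsilon> where \<epsilon>: "0 < \<epsilon>" "ball u \<epsilon> \<subseteq> S"
    using S by (meson openE)
  have near: "u - \<epsilon> / 2 \<in> S" "u + \<epsilon> / 2 \<in> S"
    using \<epsilon> by (auto intro!: subsetD[OF \<epsilon>(2)] simp: dist_real_def)
  have right: "at u within ({u<..} \<inter> S) = at_right u"
    and left: "at u within ({..<u} \<inter> S) = at_left u"
    using S by (auto intro!: at_within_nhd[of u S])
  \<comment> \<open>The slopes decrease, so their negatives are used with the limit
      theorems for increasing functions.\<close>
  obtain R where R: "((\<lambda>v. - p v) \<longlongrightarrow> - R) (at_right u)"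
  proof -
    have "((\<lambda>v. - p v) \<longlongrightarrow> Inf ((\<lambda>v. - p v) ` ({u<..} \<inter> S))) (at u within ({u<..} \<inter> S))"
      using anti near \<epsilon> by (intro Lim_right_bound[where K = "- p (u - \<epsilon> / 2)"]) auto
    then show ?thesis using that[of "- Inf ((\<lambda>v. - p v) ` ({u<..} \<inter> S))"]
      by (simp add: right)
  qed
  obtain L where L: "((\<lambda>v. - p v) \<longlongrightarrow> - L) (at_left u)"
  proof -
    have "((\<lambda>v. - p v) \<longlongrightarrow> Sup ((\<lambda>v. - p v) ` ({..<u} \<inter> S))) (at u within ({..<u} \<inter> S))"
      using anti near \<epsilon> by (intro Lim_left_bound[where K = "- p (u + \<epsilon> / 2)"]) auto
    then show ?thesis using that[of "- Sup ((\<lambda>v. - p v) ` ({..<u} \<inter> S))"]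
      by (simp add: left)
  qed
  have R': "(p \<longlongrightarrow> R) (at_right u)" and L': "(p \<longlongrightarrow> L) (at_left u)"
    using tendsto_minus[OF R] tendsto_minus[OF L] by simp_all
  have inS: "\<forall>\<^sub>F v in at u within T. v \<in> S" for T
    unfolding eventually_at_topological using S by auto
  have geR: "p w \<le> R" if "w \<in> S" "u < w" for w
  proof (rule tendsto_lowerbound[OF R'])
    show "\<forall>\<^sub>F v in at_right u. p w \<le> p v"
      using inS eventually_at_right_real[OF that(2)]
      by eventually_elim (use anti that in auto)
  qed simp
  have leL: "L \<le> p w" if "w \<in> S" "w < u" for w
  proof (rule tendsto_upperbound[OF L'])
    show "\<forall>\<^sub>F v in at_left u. p v \<le> p w"
      using inS eventually_at_left_real[OF that(2)]
      by eventually_elim (use anti that in auto)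
  qed simp
  have "R \<le> p w" if "w \<in> S" "w < u" for w
  proof (rule tendsto_upperbound[OF R'])
    show "\<forall>\<^sub>F v in at_right u. p v \<le> p w"
      using inS eventually_at_right_less[of u]
      by eventually_elim (use anti that in auto)
  qed simp
  then have RL: "R \<le> L"
    using inS[of "{..<u}"] eventually_at_left_real[of "u - 1" u]
    by (intro tendsto_lowerbound[OF L']) (auto elim: eventually_elim2)
  show ?thesis
  proof (rule that[OF _ _ RL])
    show "(F has_real_derivative R) (at_right u)" "(F has_real_derivative L) (at_left u)"
      using R' L' unfolding has_field_derivative_iff p_def by simp_all
  qed (use geR leL in \<open>auto simp: p_def\<close>)
qed

text \<open>
  The bounds are the slope bounds of the concave function \<open>u \<mapsto> f (u powr (1 / d))\<close> at \<open>r powr d\<close>,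
  transported by the chain rule; the factor \<open>d * r powr (d - 1)\<close> of the latter and the length
  \<open>(k powr d - 1) * r powr d\<close> of the interval combine to the factor in front of the increment.
\<close>

lemma Kneser_function_one_sided_derivs:
  assumes K: "Kneser_function d f" and d: "0 < d" and r: "0 < r"
  shows "right_deriv f r \<le> left_deriv f r"
    and "1 < k \<Longrightarrow> d / ((k powr d - 1) * r) * (f (k * r) - f r) \<le> right_deriv f r"
    and "0 < k \<Longrightarrow> k < 1 \<Longrightarrow> left_deriv f r \<le> d / ((1 - k powr d) * r) * (f r - f (k * r))"
proof -
  define F where "F u = f (u powr (1 / d))" for u
  define c where "c = d * r powr (d - 1)"
  have c: "0 < c" and c_eq: "c = d * r powr d / r"
    using d r by (simp_all add: c_def powr_diff)
  have F: "F (x powr d) = f x" if "0 < x" for x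
    using that d by (simp add: F_def powr_powr)
  have "concave_on {0<..} F"
    unfolding F_def using K d by (intro Kneser_order_one_concave Kneser_function_order_one)
  then obtain R L where R: "(F has_real_derivative R) (at_right (r powr d))"
    and L: "(F has_real_derivative L) (at_left (r powr d))" and RL: "R \<le> L"
    and geR: "\<And>v. v \<in> {0<..} \<Longrightarrow> r powr d < v \<Longrightarrow> (F v - F (r powr d)) / (v - r powr d) \<le> R"
    and leL: "\<And>v. v \<in> {0<..} \<Longrightarrow> v < r powr d \<Longrightarrow> L \<le> (F v - F (r powr d)) / (v - r powr d)"
    using concave_on_one_sided_derivatives[of "{0<..}" F "r powr d"] r by auto
  have powr_deriv: "((\<lambda>x. x powr d) has_real_derivative c) (at r within T)" for T
    unfolding c_def using has_real_derivative_powr[OF r] by (rule has_field_derivative_at_within)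
  \<comment> \<open>Restricting to positive arguments, where \<open>f\<close> is the composition, does not change the
      derivative at \<open>r\<close>.\<close>
  have chain: "(f has_real_derivative D * c) (at r within T)"
    if D: "(F has_real_derivative D) (at (r powr d) within T')"
      and T: "(\<lambda>x. x powr d) ` (T \<inter> {0<..}) \<subseteq> T'" for D T T'
  proof -
    have "(F \<circ> (\<lambda>x. x powr d) has_real_derivative D * c) (at r within (T \<inter> {0<..}))"
      using has_field_derivative_subset[OF D T] powr_deriv by (rule DERIV_image_chain)
    moreover have "\<forall>\<^sub>F x in at r within (T \<inter> {0<..}). (F \<circ> (\<lambda>x. x powr d)) x = f x"
      unfolding eventually_at_topological using F by auto
    ultimately have "(f has_real_derivative D * c) (at r within (T \<inter> {0<..}))"
      using r F by (subst (asm) has_field_derivative_cong_eventually) auto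
    moreover have "at r within (T \<inter> {0<..}) = at r within T"
      using r by (intro at_within_nhd[of r "{0<..}"]) auto
    ultimately show ?thesis by simp
  qed
  have right: "right_deriv f r = R * c"
    using r d by (intro right_deriv_eqI chain[OF R]) (auto intro: powr_less_mono2)
  have left: "left_deriv f r = L * c"
    using r d by (intro left_deriv_eqI chain[OF L]) (auto intro: powr_less_mono2)
  show "right_deriv f r \<le> left_deriv f r"
    using RL c by (simp add: right left)
  have kr: "F ((k * r) powr d) = f (k * r)" "F (r powr d) = f r"
    "(k * r) powr d - r powr d = (k powr d - 1) * r powr d" if "0 < k" for k
    using that r F[of "k * r"] F[of r] by (simp_all add: powr_mult algebra_simps)
  show "d / ((k powr d - 1) * r) * (f (k * r) - f r) \<le> right_deriv f r" if k: "1 < k"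
  proof -
    have "(F ((k * r) powr d) - F (r powr d)) / ((k * r) powr d - r powr d) \<le> R"
      using k r d by (intro geR) (auto intro!: powr_less_mono2)
    then have "(f (k * r) - f r) / ((k powr d - 1) * r powr d) * c \<le> R * c"
      using kr[of k] k c by (intro mult_right_mono) simp_all
    also have "(f (k * r) - f r) / ((k powr d - 1) * r powr d) * c
        = d / ((k powr d - 1) * r) * (f (k * r) - f r)"
      using r by (simp add: c_eq)
    finally show ?thesis by (simp add: right)
  qed
  show "left_deriv f r \<le> d / ((1 - k powr d) * r) * (f r - f (k * r))" if k: "0 < k" "k < 1"
  proof -
    have "k powr d < 1"
      using k d powr_less_mono2[of d k 1] by simp
    have "L \<le> (F ((k * r) powr d) - F (r powr d)) / ((k * r) powr d - r powr d)"
      using k r d by (intro leL) (auto intro!: powr_less_mono2)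
    then have "L * c \<le> (f (k * r) - f r) / ((k powr d - 1) * r powr d) * c"
      using kr[of k] k c by (intro mult_right_mono) simp_all
    also have "\<dots> = d / ((1 - k powr d) * r) * (f r - f (k * r))"
      using r \<open>k powr d < 1\<close> by (simp add: c_eq divide_simps) algebra
    finally show ?thesis by (simp add: left)
  qed
qed

section \<open>Power growth of the derivatives at zero\<close>

theorem proposition2p1:
  fixes f :: "real \<Rightarrow> real" and d s :: real
  assumes "d \<ge> 1"
    and "Kneser_function d f"
    and "s > 0"
    and "0 < Liminf (at_right 0) (\<lambda>r. ereal (f r / r powr s))"
    and "Liminf (at_right 0) (\<lambda>r. ereal (f r / r powr s))
           \<le> Limsup (at_right 0) (\<lambda>r. ereal (f r / r powr s))"
    and "Limsup (at_right 0) (\<lambda>r. ereal (f r / r powr s)) < \<infinity>"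
  shows "0 < Liminf (at_right 0) (\<lambda>r. ereal (right_deriv f r / r powr (s - 1)))
    \<and> Liminf (at_right 0) (\<lambda>r. ereal (right_deriv f r / r powr (s - 1)))
        \<le> Limsup (at_right 0) (\<lambda>r. ereal (left_deriv f r / r powr (s - 1)))
    \<and> Limsup (at_right 0) (\<lambda>r. ereal (left_deriv f r / r powr (s - 1))) < \<infinity>"
proof (intro conjI)
  note K = assms(2)
  have d: "0 < d" using assms(1) by simp
  obtain c where c: "0 < c"
    and "0 < ereal c" and "ereal c < Liminf (at_right 0) (\<lambda>r. ereal (f r / r powr s))"
    using ereal_dense2[OF assms(4)] by auto
  then have "\<forall>\<^sub>F r in at_right 0. c < f r / r powr s"
    using less_LiminfD by fastforce
  then obtain \<delta>1 where \<delta>1: "0 < \<delta>1" "\<And>r. 0 < r \<Longrightarrow> r < \<delta>1 \<Longrightarrow> c < f r / r powr s"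
    unfolding eventually_at_right_field by blast
  obtain C where "Limsup (at_right 0) (\<lambda>r. ereal (f r / r powr s)) < ereal C"
    using ereal_dense2[OF assms(6)] by auto
  then have "\<forall>\<^sub>F r in at_right 0. f r / r powr s < C"
    using Limsup_lessD by fastforce
  then obtain \<delta>2 where \<delta>2: "0 < \<delta>2" "\<And>r. 0 < r \<Longrightarrow> r < \<delta>2 \<Longrightarrow> f r / r powr s < C"
    unfolding eventually_at_right_field by blast
  define \<delta> where "\<delta> = min \<delta>1 \<delta>2"
  have \<delta>: "0 < \<delta>" using \<delta>1 \<delta>2 by (simp add: \<delta>_def)
  have lower: "c * r powr s < f r" and upper: "f r < C * r powr s" if "0 < r" "r < \<delta>" for r
    using \<delta>1(2)[of r] \<delta>2(2)[of r] that by (simp_all add: \<delta>_def field_simps)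
  have "c < C"
    using \<delta>1(2)[of "\<delta> / 2"] \<delta>2(2)[of "\<delta> / 2"] \<delta>1(1) \<delta>2(1)
    by (fastforce simp: \<delta>_def min_def split: if_splits)

  \<comment> \<open>With this \<open>k\<close> the lower bound \<open>c * (k * r) powr s\<close> at \<open>k * r\<close> is twice the upper bound at \<open>r\<close>.\<close>
  define k where "k = (2 * C / c) powr (1 / s)"
  have ks: "c * k powr s = 2 * C"
    using c \<open>c < C\<close> assms(3) by (simp add: k_def powr_powr)
  have k: "1 < k"
    unfolding k_def using c \<open>c < C\<close> assms(3) by (intro gr_one_powr) auto
  then have kd: "1 < k powr d" using d by (rule gr_one_powr)
  have "d * C / (k powr d - 1) \<le> right_deriv f r / r powr (s - 1)" if r: "0 < r" "r < \<delta> / k" for r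
  proof -
    have "r \<le> k * r" "k * r < \<delta>" using r k by (simp_all add: field_simps)
    have "2 * C * r powr s < f (k * r)"
      using lower[of "k * r"] \<open>k * r < \<delta>\<close> r k ks by (simp add: powr_mult mult.assoc[symmetric])
    then have "C * r powr s \<le> f (k * r) - f r"
      using upper[of r] r \<open>r \<le> k * r\<close> \<open>k * r < \<delta>\<close> by linarith
    then have "d / ((k powr d - 1) * r) * (C * r powr s)
        \<le> d / ((k powr d - 1) * r) * (f (k * r) - f r)"
      using d kd r by (intro mult_left_mono) auto
    also have "\<dots> \<le> right_deriv f r"
      using Kneser_function_one_sided_derivs(2)[OF K d r(1) k] .
    finally have "d / ((k powr d - 1) * r) * (C * r powr s) / r powr (s - 1)
        \<le> right_deriv f r / r powr (s - 1)"
      by (rule divide_right_mono) simp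
    then show ?thesis using r by (simp add: powr_diff)
  qed
  then have "\<forall>\<^sub>F r in at_right 0.
      ereal (d * C / (k powr d - 1)) \<le> ereal (right_deriv f r / r powr (s - 1))"
    unfolding eventually_at_right_field using \<delta> k by (intro exI[of _ "\<delta> / k"]) auto
  then have "ereal (d * C / (k powr d - 1))
      \<le> Liminf (at_right 0) (\<lambda>r. ereal (right_deriv f r / r powr (s - 1)))"
    by (rule Liminf_bounded)
  moreover have "0 < ereal (d * C / (k powr d - 1))"
    using d kd c \<open>c < C\<close> by simp
  ultimately show "0 < Liminf (at_right 0) (\<lambda>r. ereal (right_deriv f r / r powr (s - 1)))"
    by (rule less_le_trans[rotated])

  have "\<forall>\<^sub>F r in at_right 0.
      ereal (right_deriv f r / r powr (s - 1)) \<le> ereal (left_deriv f r / r powr (s - 1))"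
    using eventually_at_right_less[of 0]
    by eventually_elim
      (use Kneser_function_one_sided_derivs(1)[OF K d] in \<open>auto intro: divide_right_mono\<close>)
  then have "Liminf (at_right 0) (\<lambda>r. ereal (right_deriv f r / r powr (s - 1)))
      \<le> Liminf (at_right 0) (\<lambda>r. ereal (left_deriv f r / r powr (s - 1)))"
    by (rule Liminf_mono)
  also have "\<dots> \<le> Limsup (at_right 0) (\<lambda>r. ereal (left_deriv f r / r powr (s - 1)))"
    by (rule Liminf_le_Limsup) simp
  finally show "Liminf (at_right 0) (\<lambda>r. ereal (right_deriv f r / r powr (s - 1)))
      \<le> Limsup (at_right 0) (\<lambda>r. ereal (left_deriv f r / r powr (s - 1)))" .

  define h where "h = (1 / 2 :: real) powr d"
  have h: "h < 1" using d powr_less_mono2[of d "1/2" 1] by (simp add: h_def)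
  have "left_deriv f r / r powr (s - 1) \<le> d * C / (1 - h)" if r: "0 < r" "r < \<delta>" for r
  proof -
    have "left_deriv f r \<le> d / ((1 - h) * r) * (f r - f (1 / 2 * r))"
      unfolding h_def using Kneser_function_one_sided_derivs(3)[OF K d r(1), of "1/2"] by simp
    also have "\<dots> \<le> d / ((1 - h) * r) * (C * r powr s)"
      using d h r upper[OF r] Kneser_function_pos[OF K, of "1 / 2 * r"]
      by (intro mult_left_mono) auto
    finally have "left_deriv f r / r powr (s - 1)
        \<le> d / ((1 - h) * r) * (C * r powr s) / r powr (s - 1)"
      by (rule divide_right_mono) simp
    then show ?thesis using r by (simp add: powr_diff)
  qed
  then have "\<forall>\<^sub>F r in at_right 0.
      ereal (left_deriv f r / r powr (s - 1)) \<le> ereal (d * C / (1 - h))"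
    unfolding eventually_at_right_field using \<delta> by (intro exI[of _ \<delta>]) auto
  then have "Limsup (at_right 0) (\<lambda>r. ereal (left_deriv f r / r powr (s - 1)))
      \<le> ereal (d * C / (1 - h))"
    by (rule Limsup_bounded)
  then show "Limsup (at_right 0) (\<lambda>r. ereal (left_deriv f r / r powr (s - 1))) < \<infinity>"
    by (rule order.strict_trans1) simp
qed

end
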